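(* Let $\mathcal{A}\in\mathbb{R}^{n\times n}$ and $\sigma\in\mathbb{R}^n$, and let $\mathcal{A}=(\mathcal{M}+I+D_{\mathcal{A}})-(\mathcal{N}+I+D_{\mathcal{A}})$ be a splitting of $\mathcal{A}$ with $\mathcal{M},\mathcal{N}\in\mathbb{R}^{n\times n}$ such that $\mathcal{M}+2I+D_{\mathcal{A}}$ is nonsingular. Let $\zeta\in\mathbb{R}^n$ and $\lambda=\zeta_{+}$. Then the linear complementarity problem LCP$(\sigma,\mathcal{A})$ is equivalent to a fixed point equation: $\lambda=\zeta_+$ solves LCP$(\sigma,\mathcal{A})$ if and only if $$\zeta_{+}=(\mathcal{M}+2I+D_{\mathcal{A}})^{-1}\big[(\mathcal{N}+I+D_{\mathcal{A}})\zeta_{+}+|(\mathcal{A}-I)\zeta_{+}+\sigma|-\sigma\big].$$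
   Context: For $\mathcal{A}\in\mathbb{R}^{n\times n}$ and $\sigma\in\mathbb{R}^n$, LCP$(\sigma,\mathcal{A})$ is the problem of finding $\lambda\in\mathbb{R}^n$ with $\lambda\ge 0$, $\mathcal{A}\lambda+\sigma\ge 0$ and $\lambda^T(\mathcal{A}\lambda+\sigma)=0$ (inequalities between vectors are entrywise). $I$ is the $n\times n$ identity matrix and $D_{\mathcal{A}}$ is the diagonal matrix with the same diagonal as $\mathcal{A}$. For a vector $\zeta$, $\zeta_+=\max\{0,\zeta\}$ entrywise, and $|\cdot|$ of a vector is the entrywise absolute value. *)

theory Defs
  imports "HOL-Analysis.Analysis"
begin

text \<open>On \<^typ>\<open>real ^ 'n\<close> the library order \<open>\<le>\<close> and the absolute value \<open>\<bar>_\<bar>\<close> are both entrywise.\<close>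

definition solves_LCP :: "real ^ 'n \<Rightarrow> real ^ 'n ^ 'n \<Rightarrow> real ^ 'n \<Rightarrow> bool" where
  "solves_LCP \<sigma> A l \<longleftrightarrow> 0 \<le> l \<and> 0 \<le> A *v l + \<sigma> \<and> l \<bullet> (A *v l + \<sigma>) = 0"

definition diag_part :: "real ^ 'n ^ 'n \<Rightarrow> real ^ 'n ^ 'n" where
  "diag_part A = (\<chi> i j. if i = j then A $ i $ j else 0)"

definition pos_part :: "real ^ 'n \<Rightarrow> real ^ 'n" where
  "pos_part z = (\<chi> i. max 0 (z $ i))"

end

theory Submission
  imports Defs
begin

text \<open>
  With \<open>w = A l + \<sigma>\<close>, the splitting says that \<open>M + 2 I + D\<close> and \<open>N + I + D\<close> differ by \<open>A + I\<close>,
  where \<open>D\<close> is the diagonal part of \<open>A\<close>. Multiplying the fixed point equation by the nonsingular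
  matrix \<open>M + 2 I + D\<close> therefore turns it into \<open>l + w = \<bar>w - l\<bar>\<close>. This is an entrywise equation
  (\<open>LCP_iff_abs_equation\<close>), and for real numbers \<open>a + b = \<bar>b - a\<bar>\<close> is the complementarity
  condition \<open>a \<ge> 0\<close>, \<open>b \<ge> 0\<close>, \<open>a b = 0\<close>. Indeed squaring shows that the two sides agree up to sign
  exactly when \<open>4 a b = 0\<close>, and when one of two numbers is zero, their sum is nonnegative exactly
  when both are.
\<close>

lemma complementary_iff_abs_equation:
  fixes a b :: real
  shows "0 \<le> a \<and> 0 \<le> b \<and> a * b = 0 \<longleftrightarrow> a + b = \<bar>b - a\<bar>"
  by (auto simp: abs_if)

text \<open>A sum of nonnegative terms vanishes only if each term does; this makes the single scalar
  equation \<open>u \<bullet> v = 0\<close> an entrywise condition.\<close>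

lemma nonneg_orthogonal_iff_complementary:
  fixes u v :: "real ^ 'n"
  shows "0 \<le> u \<and> 0 \<le> v \<and> u \<bullet> v = 0
    \<longleftrightarrow> (\<forall>i. 0 \<le> u $ i \<and> 0 \<le> v $ i \<and> u $ i * v $ i = 0)"
proof (cases "0 \<le> u \<and> 0 \<le> v")
  case True
  then have "u \<bullet> v = 0 \<longleftrightarrow> (\<forall>i. u $ i * v $ i = 0)"
    by (simp add: inner_vec_def sum_nonneg_eq_0_iff less_eq_vec_def)
  then show ?thesis
    using True by (auto simp: less_eq_vec_def)
qed (auto simp: less_eq_vec_def)

lemma LCP_iff_abs_equation:
  "solves_LCP \<sigma> A l \<longleftrightarrow> l + (A *v l + \<sigma>) = \<bar>(A *v l + \<sigma>) - l\<bar>"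
  unfolding solves_LCP_def nonneg_orthogonal_iff_complementary complementary_iff_abs_equation
  by (simp add: vec_eq_iff abs_vec_def)

lemma eq_matrix_inv_mult_iff:
  fixes P :: "real ^ 'n ^ 'n"
  assumes "invertible P"
  shows "x = matrix_inv P *v y \<longleftrightarrow> P *v x = y"
proof -
  have "P ** matrix_inv P = mat 1 \<and> matrix_inv P ** P = mat 1"
    using assms unfolding invertible_def matrix_inv_def by (rule someI_ex)
  then show ?thesis
    by (metis matrix_vector_mul_assoc matrix_vector_mul_lid)
qed

theorem theorem3p1:
  fixes A M N :: "real ^ 'n ^ 'n" and \<sigma> \<zeta> l :: "real ^ 'n"
  assumes splitting: "A = (M + mat 1 + diag_part A) - (N + mat 1 + diag_part A)"
    and nonsing: "invertible (M + 2 *\<^sub>R mat 1 + diag_part A)"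
    and l: "l = pos_part \<zeta>"
  shows "solves_LCP \<sigma> A l \<longleftrightarrow>
    pos_part \<zeta> = matrix_inv (M + 2 *\<^sub>R mat 1 + diag_part A) *v
      ((N + mat 1 + diag_part A) *v pos_part \<zeta>
        + \<bar>(A - mat 1) *v pos_part \<zeta> + \<sigma>\<bar> - \<sigma>)"
proof -
  let ?P = "M + 2 *\<^sub>R mat 1 + diag_part A" and ?Q = "N + mat 1 + diag_part A"
  have "?P = ?Q + (A + mat 1)"
    using splitting by (simp add: algebra_simps scaleR_2)
  then have P: "?P *v l = ?Q *v l + (A *v l + l)"
    by (simp only: matrix_vector_mult_add_rdistrib matrix_vector_mul_lid)
  have shifted: "(A - mat 1) *v l + \<sigma> = (A *v l + \<sigma>) - l"
    by (simp add: matrix_vector_mult_diff_rdistrib)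
  have "l = matrix_inv ?P *v (?Q *v l + \<bar>(A - mat 1) *v l + \<sigma>\<bar> - \<sigma>)
    \<longleftrightarrow> ?P *v l = ?Q *v l + \<bar>(A *v l + \<sigma>) - l\<bar> - \<sigma>"
    unfolding eq_matrix_inv_mult_iff[OF nonsing] shifted ..
  also have "\<dots> \<longleftrightarrow> l + (A *v l + \<sigma>) = \<bar>(A *v l + \<sigma>) - l\<bar>"
    unfolding P by (auto simp: algebra_simps)
  finally show ?thesis
    unfolding LCP_iff_abs_equation l ..
qed

end
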